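(* Let $p$ be a prime. The series \[ \widetilde{\exp}_p(x,z)=\prod_{i=0}^\infty H\big((-1)^i g_i\big) \] is an element of $\mathcal{S}_p$ and is an exponential function in characteristic $p$, that is, \[ (\widetilde{\exp}_p)'=\widetilde{\exp}_p. \]
   Context: $\mathcal{R}_p=\mathbb{F}_p(z_1,z_2,\ldots)((x))$ is the field of formal Laurent series in $x$ whose coefficients are rational functions over $\mathbb{F}_p$ in countably many variables $z_i$ (each single coefficient involves only finitely many of them), with the $\mathbb{F}_p$-derivation $y\mapsto y'$, acting termwise on series in $x$, given by $x'=1$, $z_1'=\frac1x$, $z_i'=\frac{1}{xz_1\cdots z_{i-1}}$ for $i\ge2$. Put $w_k=z_1^{p^{k-1}}z_2^{p^{k-2}}\cdots z_{k-1}^{p}z_k$ (so $w_1=z_1$, $w_2=z_1^pz_2$); $\mathcal{S}_p$ is the closure of $\mathbb{F}_p[x,x^pw_1,x^{p^2}w_2,\ldots]$ in $\mathcal{R}_p$ for the $x$-adic topology. Let $H(t)=\prod_{k=1}^{p-1}\left(1-\frac{t}{k}\right)^k\in\mathbb{F}_p[t]$. For a series $f$ of positive order in $x$ let $\sigma(f)=\sum_{k=0}^\infty f^{p^k}$. Define recursively $g_0=\sigma(x)=\sum_{k\ge0}x^{p^k}$ and $g_{i+1}=\sigma(g_i^p z_{i+1})$ for $i\ge0$. The infinite product converges in the $x$-adic topology since $g_i\in x^{p^i}\mathbb{F}_p[z_1,z_2,\ldots][[x]]$. *)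

theory Defs
  imports
    "HOL-Analysis.Infinite_Products"
    "HOL-Computational_Algebra.Formal_Laurent_Series"
    "HOL-Computational_Algebra.Polynomial_Factorial"
    "HOL-Library.Poly_Mapping"
    "Berlekamp_Zassenhaus.Finite_Field"
begin

text \<open>
  The prime is \<open>p = CARD('p)\<close> for a type \<open>'p\<close> of class \<^class>\<open>prime_card\<close>, and
  \<open>'p mod_ring\<close> is the field with \<open>p\<close> elements.  Variables are indexed from 0: the variable with
  index \<open>i\<close> is the mathematical $z_{i+1}$.
\<close>

type_synonym 'p zpoly = "(nat \<Rightarrow>\<^sub>0 nat) \<Rightarrow>\<^sub>0 'p mod_ring"
type_synonym 'p zfrac = "'p zpoly fract"
type_synonym 'p Rp = "'p zfrac fls"

definition zvar :: "nat \<Rightarrow> 'p::prime_card zfrac" where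
  "zvar i = to_fract (Poly_Mapping.single (Poly_Mapping.single i 1) 1)"

definition scal :: "'p::prime_card mod_ring \<Rightarrow> 'p Rp" where
  "scal c = fls_const (to_fract (Poly_Mapping.single 0 c))"

definition zR :: "nat \<Rightarrow> 'p::prime_card Rp" where
  "zR i = fls_const (zvar i)"


subsection \<open>The derivation\<close>

definition zvars :: "'p::prime_card zpoly \<Rightarrow> nat set" where
  "zvars P = (\<Union>m\<in>Poly_Mapping.keys P. Poly_Mapping.keys m)"

definition partial :: "nat \<Rightarrow> 'p::prime_card zpoly \<Rightarrow> 'p zpoly" where
  "partial i P = (\<Sum>m\<in>Poly_Mapping.keys P.
     Poly_Mapping.single (m - Poly_Mapping.single i 1)
       (of_nat (Poly_Mapping.lookup m i) * Poly_Mapping.lookup P m))"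

text \<open>
  Every $z_i'$ is $x^{-1}$ times a rational function in the variables, so on coefficients
  $a' = x^{-1}\,\delta(a)$ where \<open>\<delta>\<close> is the derivation of the field of rational
  functions with $\delta(z_i) = 1/(z_1 \cdots z_{i-1})$.  On polynomials \<open>\<delta>\<close> is given by the
  chain rule, on fractions by the quotient rule; \<open>delta_Fract\<close> below shows that the choice of
  the representing fraction does not matter.
\<close>

definition delta_poly :: "'p::prime_card zpoly \<Rightarrow> 'p zfrac" where
  "delta_poly P = (\<Sum>i\<in>zvars P. to_fract (partial i P) * (1 / (\<Prod>j<i. zvar j)))"

definition delta :: "'p::prime_card zfrac \<Rightarrow> 'p zfrac" where
  "delta q = (case (SOME (a, b). b \<noteq> 0 \<and> q = Fract a b) of (a, b) \<Rightarrow>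
     (delta_poly a * to_fract b - to_fract a * delta_poly b) / to_fract b ^ 2)"

definition coeff_delta :: "'p::prime_card Rp \<Rightarrow> 'p Rp" where
  "coeff_delta f = Abs_fls (\<lambda>n. delta (fls_nth f n))"

text \<open>
  Termwise, $(a x^n)' = x^{-1}\,\delta(a) x^n + n a x^{n-1}$; the second part is the library's
  formal derivative.
\<close>

definition Rp_deriv :: "'p::prime_card Rp \<Rightarrow> 'p Rp" where
  "Rp_deriv f = fls_X_inv * coeff_delta f + fls_deriv f"


text \<open>
  The facts below confirm that \<open>Rp_deriv\<close> is a derivation over $\mathbb{F}_p$ with the prescribed
  values on $x$ and the variables.
\<close>

lemma single_sum_lookup: "P = (\<Sum>m\<in>Poly_Mapping.keys P. Poly_Mapping.single m (Poly_Mapping.lookup P m))"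
  for P :: "'b \<Rightarrow>\<^sub>0 'c::comm_monoid_add"
  by (rule poly_mapping_eqI)
     (simp add: lookup_sum lookup_single when_def in_keys_iff)

lemma partial_superset:
  assumes "finite A" "Poly_Mapping.keys P \<subseteq> A"
  shows "partial i P = (\<Sum>m\<in>A. Poly_Mapping.single (m - Poly_Mapping.single i 1)
       (of_nat (Poly_Mapping.lookup m i) * Poly_Mapping.lookup P m))"
  unfolding partial_def
  by (rule sum.mono_neutral_left) (use assms in \<open>auto simp: in_keys_iff\<close>)

lemma partial_0 [simp]: "partial i 0 = 0"
  by (simp add: partial_def)

lemma partial_add: "partial i (P + Q) = partial i P + partial i Q"
proof -
  let ?A = "Poly_Mapping.keys P \<union> Poly_Mapping.keys Q"
  have "Poly_Mapping.keys (P + Q) \<subseteq> ?A" by (rule Poly_Mapping.keys_add)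
  then show ?thesis
    by (simp add: partial_superset[of ?A] lookup_add distrib_left single_add sum.distrib)
qed

lemma partial_sum: "partial i (sum F A) = (\<Sum>x\<in>A. partial i (F x))"
  by (induction A rule: infinite_finite_induct) (simp_all add: partial_add)

lemma partial_single:
  "partial i (Poly_Mapping.single m c) =
     Poly_Mapping.single (m - Poly_Mapping.single i 1) (of_nat (Poly_Mapping.lookup m i) * c)"
  by (simp add: partial_superset[of "{m}"])

lemma minus_single_add:
  "of_nat (Poly_Mapping.lookup m i) * c = 0 \<or>
   m - Poly_Mapping.single i 1 + n = m + n - Poly_Mapping.single i (1::nat)" for c :: "'c::semiring_1"
proof (cases "Poly_Mapping.lookup m i = 0")
  case False
  then have "m - Poly_Mapping.single i 1 + n = m + n - Poly_Mapping.single i 1"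
    by (intro poly_mapping_eqI) (auto simp: lookup_add lookup_minus lookup_single when_def)
  then show ?thesis ..
qed simp

lemma partial_mult_single:
  "partial i (Poly_Mapping.single m c * Poly_Mapping.single n d) =
     partial i (Poly_Mapping.single m c) * Poly_Mapping.single n d
     + Poly_Mapping.single m c * partial i (Poly_Mapping.single n d)"
proof -
  have 1: "Poly_Mapping.single (m - Poly_Mapping.single i 1 + n) (of_nat (Poly_Mapping.lookup m i) * (c * d))
     = Poly_Mapping.single (m + n - Poly_Mapping.single i 1) (of_nat (Poly_Mapping.lookup m i) * (c * d))"
    using minus_single_add[of m i "c * d" n] by (metis single_zero)
  have 2: "Poly_Mapping.single (m + (n - Poly_Mapping.single i 1)) (of_nat (Poly_Mapping.lookup n i) * (c * d))
     = Poly_Mapping.single (m + n - Poly_Mapping.single i 1) (of_nat (Poly_Mapping.lookup n i) * (c * d))"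
    using minus_single_add[of n i "c * d" m] by (metis single_zero add.commute)
  show ?thesis using 1 2
    by (simp add: partial_single mult_single lookup_add ring_distribs single_add mult_ac add_ac)
qed

lemma partial_mult: "partial i (P * Q) = partial i P * Q + P * partial i Q"
proof -
  let ?s = "\<lambda>P m. Poly_Mapping.single m (Poly_Mapping.lookup P m)"
  have "partial i (sum (?s P) A * sum (?s Q) B) =
      partial i (sum (?s P) A) * sum (?s Q) B + sum (?s P) A * partial i (sum (?s Q) B)" for A B
    unfolding sum_product partial_sum partial_mult_single sum.distrib ..
  from this[of "Poly_Mapping.keys P" "Poly_Mapping.keys Q"] show ?thesis
    unfolding single_sum_lookup[symmetric] .
qed

lemma finite_zvars [simp]: "finite (zvars P)"
  by (simp add: zvars_def)

lemma partial_notin_zvars: "i \<notin> zvars P \<Longrightarrow> partial i P = 0"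
  unfolding partial_def zvars_def by (rule sum.neutral) (auto simp: in_keys_iff)

lemma delta_poly_superset:
  assumes "finite A" "zvars P \<subseteq> A"
  shows "delta_poly P = (\<Sum>i\<in>A. to_fract (partial i P) * (1 / (\<Prod>j<i. zvar j)))"
  unfolding delta_poly_def
  by (rule sum.mono_neutral_left) (use assms in \<open>auto simp: partial_notin_zvars\<close>)

lemma delta_poly_add: "delta_poly (P + Q) = delta_poly P + delta_poly Q"
proof -
  let ?A = "zvars P \<union> zvars Q \<union> zvars (P + Q)"
  have "finite ?A" "zvars P \<subseteq> ?A" "zvars Q \<subseteq> ?A" "zvars (P + Q) \<subseteq> ?A" by auto
  then show ?thesis
    by (simp only: delta_poly_superset[of ?A] partial_add to_fract_add distrib_right sum.distrib)
qed

lemma delta_poly_mult: "delta_poly (P * Q) = delta_poly P * to_fract Q + to_fract P * delta_poly Q"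
proof -
  let ?A = "zvars P \<union> zvars Q \<union> zvars (P * Q)"
  have *: "finite ?A" "zvars P \<subseteq> ?A" "zvars Q \<subseteq> ?A" "zvars (P * Q) \<subseteq> ?A" by auto
  let ?r = "\<lambda>i. 1 / (\<Prod>j<i. zvar j) :: 'a zfrac"
  have "delta_poly (P * Q) = (\<Sum>i\<in>?A. to_fract (partial i (P * Q)) * ?r i)"
    by (rule delta_poly_superset[OF *(1,4)])
  also have "\<dots> = (\<Sum>i\<in>?A. to_fract (partial i P) * ?r i * to_fract Q
      + to_fract P * (to_fract (partial i Q) * ?r i))"
  proof (rule sum.cong[OF refl])
    fix i
    have "(a * b + c * d) * r = a * r * b + c * (d * r)" for a b c d r :: "'a zfrac"
      by (simp only: ring_distribs mult_ac)
    then show "to_fract (partial i (P * Q)) * ?r i = to_fract (partial i P) * ?r i * to_fract Q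
      + to_fract P * (to_fract (partial i Q) * ?r i)"
      unfolding partial_mult to_fract_add to_fract_mult by blast
  qed
  also have "\<dots> = (\<Sum>i\<in>?A. to_fract (partial i P) * ?r i) * to_fract Q
      + to_fract P * (\<Sum>i\<in>?A. to_fract (partial i Q) * ?r i)"
    unfolding sum.distrib by (simp only: sum_distrib_left sum_distrib_right)
  also have "(\<Sum>i\<in>?A. to_fract (partial i P) * ?r i) = delta_poly P"
    by (rule delta_poly_superset[OF *(1,2), symmetric])
  also have "(\<Sum>i\<in>?A. to_fract (partial i Q) * ?r i) = delta_poly Q"
    by (rule delta_poly_superset[OF *(1,3), symmetric])
  finally show ?thesis .
qed

lemma delta_poly_single_0 [simp]: "delta_poly (Poly_Mapping.single 0 c) = 0"
  by (simp add: delta_poly_def partial_single)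

lemma delta_poly_var: "delta_poly (Poly_Mapping.single (Poly_Mapping.single i 1) 1) = 1 / (\<Prod>j<i. zvar j)"
proof -
  have "delta_poly (Poly_Mapping.single (Poly_Mapping.single i 1) 1) =
    (\<Sum>k\<in>{i}. to_fract (partial k (Poly_Mapping.single (Poly_Mapping.single i 1) 1)) * (1 / (\<Prod>j<k. zvar j)))"
    by (rule delta_poly_superset) (auto simp: zvars_def)
  then show ?thesis by (simp add: partial_single)
qed

lemma delta_Fract:
  assumes "b \<noteq> 0"
  shows "delta (Fract a b) = (delta_poly a * to_fract b - to_fract a * delta_poly b) / to_fract b ^ 2"
proof -
  define r where "r = (SOME (a', b'). b' \<noteq> 0 \<and> Fract a b = Fract a' b')"
  have "case r of (a', b') \<Rightarrow> b' \<noteq> 0 \<and> Fract a b = Fract a' b'"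
    unfolding r_def by (rule someI[of _ "(a, b)"]) (use assms in auto)
  then obtain a' b' where r: "r = (a', b')" "b' \<noteq> 0" "a * b' = a' * b"
    using assms by (auto simp: eq_fract split: prod.splits)
  have e: "to_fract a * to_fract b' = to_fract a' * to_fract b"
    using r(3) by (metis to_fract_mult)
  have d: "delta_poly a * to_fract b' + to_fract a * delta_poly b' =
      delta_poly a' * to_fract b + to_fract a' * delta_poly b"
    using r(3) delta_poly_mult by metis
  have nz: "to_fract b \<noteq> 0" "to_fract b' \<noteq> 0" using assms r by auto
  define A B A' B' DA DB DA' DB' where defs: "A = to_fract a" "B = to_fract b" "A' = to_fract a'"
    "B' = to_fract b'" "DA = delta_poly a" "DB = delta_poly b" "DA' = delta_poly a'" "DB' = delta_poly b'"
  have e: "A * B' = A' * B" and d: "DA * B' + A * DB' = DA' * B + A' * DB" and nz: "B \<noteq> 0" "B' \<noteq> 0"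
    using e d nz unfolding defs by auto
  have d': "DA * B' = DA' * B + A' * DB - A * DB'"
    using d by (simp add: eq_diff_eq)
  have "(DA * B - A * DB) * B' ^ 2 = B * B' * (DA * B') - (A * B') * DB * B'"
    by (simp add: power2_eq_square algebra_simps)
  also have "\<dots> = B * B' * (DA' * B + A' * DB - A * DB') - (A' * B) * DB * B'"
    unfolding d' e ..
  also have "\<dots> = B ^ 2 * B' * DA' - B * DB' * (A * B')"
    by (simp add: power2_eq_square algebra_simps)
  also have "\<dots> = (DA' * B' - A' * DB') * B ^ 2"
    unfolding e by (simp add: power2_eq_square algebra_simps)
  finally have "(DA * B - A * DB) / B ^ 2 = (DA' * B' - A' * DB') / B' ^ 2"
    using nz by (simp add: frac_eq_eq)
  then show ?thesis
    unfolding delta_def r_def[symmetric] r by (simp add: defs)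
qed

lemma delta_to_fract [simp]: "delta (to_fract P) = delta_poly P"
proof -
  have "delta_poly (1 :: 'a zpoly) = 0"
    using delta_poly_single_0[of "1 :: 'a mod_ring"] by (simp del: delta_poly_single_0)
  then show ?thesis
    using delta_Fract[of 1 P] by (simp flip: to_fract_def)
qed

lemma Fract_conv: "b \<noteq> 0 \<Longrightarrow> Fract a b = to_fract a / to_fract b"
  by (simp add: to_fract_def)

lemma delta_add: "delta (q + r) = delta q + delta r"
proof -
  obtain a b where q: "q = Fract a b" "b \<noteq> 0" by (cases q)
  obtain c d where r: "r = Fract c d" "d \<noteq> 0" by (cases r)
  show ?thesis using q(2) r(2)
    by (simp add: q(1) r(1) delta_Fract delta_poly_add delta_poly_mult divide_simps)
       (simp add: power2_eq_square algebra_simps)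
qed

lemma delta_mult: "delta (q * r) = delta q * r + q * delta r"
proof -
  obtain a b where q: "q = Fract a b" "b \<noteq> 0" by (cases q)
  obtain c d where r: "r = Fract c d" "d \<noteq> 0" by (cases r)
  have e: "delta (q * r) = (delta_poly (a * c) * to_fract (b * d) - to_fract (a * c) * delta_poly (b * d))
      / to_fract (b * d) ^ 2"
    unfolding q(1) r(1) mult_fract by (rule delta_Fract) (use q r in simp)
  have nz: "to_fract b \<noteq> 0" "to_fract d \<noteq> 0" using q r by auto
  have dq: "delta q = (delta_poly a * to_fract b - to_fract a * delta_poly b) / to_fract b ^ 2"
    unfolding q(1) by (rule delta_Fract[OF q(2)])
  have dr: "delta r = (delta_poly c * to_fract d - to_fract c * delta_poly d) / to_fract d ^ 2"
    unfolding r(1) by (rule delta_Fract[OF r(2)])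
  have qr: "q = to_fract a / to_fract b" "r = to_fract c / to_fract d"
    unfolding q(1) r(1) by (rule Fract_conv, fact)+
  show ?thesis
    unfolding e dq dr unfolding qr delta_poly_mult to_fract_mult
    using nz by (simp add: divide_simps) (simp add: power2_eq_square algebra_simps)
qed

lemma delta_0 [simp]: "delta 0 = 0"
  using delta_add[of 0 0] by (metis add_0_left add_cancel_right_left)

lemma delta_1 [simp]: "delta 1 = 0"
  using delta_mult[of 1 1] by (metis mult_1_left mult_1_right add_cancel_right_left)

lemma delta_sum: "delta (sum F A) = (\<Sum>x\<in>A. delta (F x))"
  by (induction A rule: infinite_finite_induct) (simp_all add: delta_add)

lemma delta_zvar: "delta (zvar i) = 1 / (\<Prod>j<i. zvar j)"
  by (simp only: zvar_def[of i] delta_to_fract delta_poly_var)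

lemma coeff_delta_nth [simp]: "fls_nth (coeff_delta f) n = delta (fls_nth f n)"
  unfolding coeff_delta_def
  by (rule nth_Abs_fls_lower_bound[of "fls_subdegree f"]) simp

lemma fls_times_nth_bounds:
  fixes f h :: "'a::comm_ring_1 fls"
  assumes "\<And>i. i < A \<Longrightarrow> fls_nth f i = 0" "\<And>i. i < B \<Longrightarrow> fls_nth h i = 0"
  shows "fls_nth (f * h) n = (\<Sum>i=A..n - B. fls_nth f i * fls_nth h (n - i))"
proof -
  let ?C = "{min A (fls_subdegree f)..max (n - B) (n - fls_subdegree h)}"
  have "fls_nth (f * h) n = (\<Sum>i\<in>?C. fls_nth f i * fls_nth h (n - i))"
    unfolding fls_times_nth(2)
    by (rule sum.mono_neutral_left) auto
  also have "\<dots> = (\<Sum>i=A..n - B. fls_nth f i * fls_nth h (n - i))"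
    by (rule sum.mono_neutral_right) (use assms in auto)
  finally show ?thesis .
qed

lemma coeff_delta_mult: "coeff_delta (f * h) = coeff_delta f * h + f * coeff_delta h"
proof (rule fls_eqI)
  fix n
  let ?A = "fls_subdegree f" and ?B = "fls_subdegree h"
  have *: "\<And>i. i < ?A \<Longrightarrow> fls_nth f i = 0" "\<And>i. i < ?B \<Longrightarrow> fls_nth h i = 0"
    "\<And>i. i < ?A \<Longrightarrow> fls_nth (coeff_delta f) i = 0" "\<And>i. i < ?B \<Longrightarrow> fls_nth (coeff_delta h) i = 0"
    by auto
  show "fls_nth (coeff_delta (f * h)) n = fls_nth (coeff_delta f * h + f * coeff_delta h) n"
    by (simp add: fls_times_nth_bounds[OF *(1,2)] fls_times_nth_bounds[OF *(3,2)]
          fls_times_nth_bounds[OF *(1,4)] delta_sum delta_mult sum.distrib)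
qed

lemma Rp_deriv_add: "Rp_deriv (f + h) = Rp_deriv f + Rp_deriv h"
proof -
  have "coeff_delta (f + h) = coeff_delta f + coeff_delta h"
    by (rule fls_eqI) (simp add: delta_add)
  then show ?thesis by (simp add: Rp_deriv_def algebra_simps)
qed

lemma Rp_deriv_mult: "Rp_deriv (f * h) = Rp_deriv f * h + f * Rp_deriv h"
  by (simp add: Rp_deriv_def coeff_delta_mult algebra_simps)

lemma Rp_deriv_scal: "Rp_deriv (scal c) = 0"
proof -
  have "coeff_delta (scal c) = 0"
    by (rule fls_eqI) (simp add: scal_def)
  then show ?thesis by (simp add: Rp_deriv_def scal_def)
qed

lemma Rp_deriv_X: "Rp_deriv fls_X = 1"
proof -
  have "coeff_delta fls_X = 0"
    by (rule fls_eqI) simp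
  then show ?thesis by (simp add: Rp_deriv_def)
qed

lemma Rp_deriv_z: "Rp_deriv (zR i) = 1 / (fls_X * (\<Prod>j<i. zR j))"
proof -
  have 1: "coeff_delta (zR i) = fls_const (1 / (\<Prod>j<i. zvar j))"
    by (rule fls_eqI) (simp add: zR_def delta_zvar)
  have 2: "(\<Prod>j<i. zR j) = fls_const (\<Prod>j<i. zvar j)"
    by (induction i) (simp_all add: zR_def)
  show ?thesis
    by (simp add: Rp_deriv_def 1 2) (simp add: zR_def divide_inverse fls_inverse_X fls_inverse_const)
qed


subsection \<open>The closed subring\<close>

text \<open>$w_k = z_1^{p^{k-1}} z_2^{p^{k-2}} \cdots z_{k-1}^p z_k$, with the index shift for \<open>zR\<close>.\<close>

definition wR :: "nat \<Rightarrow> 'p::prime_card Rp" where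
  "wR k = (\<Prod>j<k. zR j ^ (CARD('p) ^ (k - 1 - j)))"

inductive_set Fp_algebra :: "'p::prime_card Rp set \<Rightarrow> 'p Rp set" for G where
  scal: "scal c \<in> Fp_algebra G"
| gen: "g \<in> G \<Longrightarrow> g \<in> Fp_algebra G"
| add: "f \<in> Fp_algebra G \<Longrightarrow> g \<in> Fp_algebra G \<Longrightarrow> f + g \<in> Fp_algebra G"
| mult: "f \<in> Fp_algebra G \<Longrightarrow> g \<in> Fp_algebra G \<Longrightarrow> f * g \<in> Fp_algebra G"

text \<open>The metric of \<^typ>\<open>'a fls\<close> from the library induces the $x$-adic topology.\<close>

definition Sp :: "'p::prime_card Rp set" where
  "Sp = closure (Fp_algebra (insert fls_X {fls_X ^ (CARD('p) ^ k) * wR k | k. 1 \<le> k}))"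


subsection \<open>The exponential product\<close>

definition Hpoly :: "'p::prime_card mod_ring poly" where
  "Hpoly = (\<Prod>k = 1..<CARD('p). [:1, - (1 / of_nat k):] ^ k)"

definition H_eval :: "'p::prime_card Rp \<Rightarrow> 'p Rp" where
  "H_eval f = poly (map_poly scal Hpoly) f"

definition sigma :: "'p::prime_card Rp \<Rightarrow> 'p Rp" where
  "sigma f = suminf (\<lambda>k. f ^ (CARD('p) ^ k))"

primrec gR :: "nat \<Rightarrow> 'p::prime_card Rp" where
  "gR 0 = sigma fls_X"
| "gR (Suc i) = sigma (gR i ^ CARD('p) * zR i)"

definition exp_tilde :: "'p::prime_card Rp" where
  "exp_tilde = prodinf (\<lambda>i. H_eval ((-1) ^ i * gR i))"

subsection \<open>Convergence\<close>

definition order_ge :: "int \<Rightarrow> 'a::zero fls \<Rightarrow> bool" where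
  "order_ge d f \<longleftrightarrow> (\<forall>n<d. fls_nth f n = 0)"

lemma order_ge_mono: "order_ge d f \<Longrightarrow> e \<le> d \<Longrightarrow> order_ge e f"
  by (auto simp: order_ge_def)

lemma order_ge_mult:
  fixes f h :: "'a::comm_ring_1 fls"
  assumes "order_ge d f" "order_ge e h"
  shows "order_ge (d + e) (f * h)"
  using fls_times_nth_bounds[of d f e h] assms by (auto simp: order_ge_def)

lemma order_ge_add: "order_ge d f \<Longrightarrow> order_ge d h \<Longrightarrow> order_ge d (f + h)"
  for f h :: "'a::comm_ring_1 fls"
  by (auto simp: order_ge_def)

lemma order_ge_const [simp]: "order_ge 0 (fls_const c)"
  by (auto simp: order_ge_def)

lemma order_ge_0 [simp]: "order_ge d 0"
  by (auto simp: order_ge_def)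

lemma order_ge_1 [simp]: "order_ge 0 (1 :: 'a::comm_ring_1 fls)"
  by (auto simp: order_ge_def)

lemma order_ge_power:
  fixes f :: "'a::comm_ring_1 fls"
  assumes "order_ge d f"
  shows "order_ge (int k * d) (f ^ k)"
proof (induction k)
  case (Suc k)
  then show ?case using order_ge_mult[OF assms Suc] by (simp add: algebra_simps)
qed simp

lemma fls_converges:
  fixes S :: "nat \<Rightarrow> 'a::comm_ring_1 fls"
  assumes "\<And>k. order_ge (int k + 1) (S (Suc k) - S k)"
  obtains L where "S \<longlonglongrightarrow> L" "\<And>k. order_ge (int k + 1) (L - S k)"
proof
  define L where "L = Abs_fls (\<lambda>n. fls_nth (S (nat n)) n)"
  have L: "fls_nth L n = fls_nth (S (nat n)) n" for n
    unfolding L_def by (rule nth_Abs_fls_lower_bound[of "min 0 (fls_subdegree (S 0))"]) auto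
  have st: "fls_nth (S k) n = fls_nth (S (nat n)) n" if "n \<le> int k" for k n
  proof -
    have "nat n \<le> k" using that by simp
    then show ?thesis
    proof (induction k rule: dec_induct)
      case (step k)
      have "n < int k + 1" using step(1) by simp
      then have "fls_nth (S (Suc k) - S k) n = 0"
        using assms[of k] by (auto simp: order_ge_def)
      with step show ?case by simp
    qed simp
  qed
  show o: "order_ge (int k + 1) (L - S k)" for k
    using st[of _ k] by (auto simp: order_ge_def L)
  have "dist (S k) L \<le> inverse 2 ^ k" for k
  proof (cases "S k = L")
    case False
    then have "fls_nth (S k - L) (fls_subdegree (S k - L)) \<noteq> 0"
      by (intro nth_fls_subdegree_nonzero) simp
    with o[of k] have "int k + 1 \<le> fls_subdegree (S k - L)"
      by (force simp: order_ge_def not_less[symmetric])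
    then have "int k \<le> fls_subdegree (S k - L)" "k \<le> nat (fls_subdegree (S k - L))" by auto
    then have "inverse (2 ^ nat (fls_subdegree (S k - L))) \<le> (inverse (2 ^ k) :: real)"
      by (intro le_imp_inverse_le power_increasing) auto
    with \<open>int k \<le> fls_subdegree (S k - L)\<close> show ?thesis using False
      by (simp add: dist_fls_def power_one_over inverse_eq_divide)
  qed simp
  moreover have "(\<lambda>k. inverse 2 ^ k :: real) \<longlonglongrightarrow> 0"
    by (rule LIMSEQ_realpow_zero) auto
  ultimately have "(\<lambda>k. dist (S k) L) \<longlonglongrightarrow> 0"
    by (rule_tac tendsto_sandwich[of "\<lambda>_. 0" _ _ "\<lambda>k. inverse 2 ^ k"]) auto
  then show "S \<longlonglongrightarrow> L" by (rule tendsto_dist_iff[THEN iffD2])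
qed

lemma sigma_converges:
  fixes f :: "'p::prime_card Rp"
  assumes "order_ge d f" "d \<ge> 1"
  shows "(\<lambda>k. f ^ (CARD('p) ^ k)) sums sigma f" "order_ge d (sigma f)"
proof -
  have p: "CARD('p) \<ge> 2" using prime_card[where 'a='p] by (rule prime_ge_2_nat)
  have po: "order_ge (int (CARD('p) ^ k) * d) (f ^ (CARD('p) ^ k))" for k
    by (rule order_ge_power[OF assms(1)])
  have od: "order_ge d (f ^ (CARD('p) ^ k))" for k
  proof (rule order_ge_mono[OF po])
    have "1 * d \<le> int (CARD('p) ^ k) * d"
      using assms(2) p by (intro mult_right_mono) auto
    then show "d \<le> int (CARD('p) ^ k) * d" by simp
  qed
  have ok: "order_ge (int k + 1) (f ^ (CARD('p) ^ k))" for k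
  proof (rule order_ge_mono[OF po])
    have "k < 2 ^ k" by (rule less_exp)
    also have "(2::nat) ^ k \<le> CARD('p) ^ k" using p by (rule power_mono) auto
    finally have "int k + 1 \<le> int (CARD('p) ^ k) * 1" by linarith
    also have "\<dots> \<le> int (CARD('p) ^ k) * d" using assms(2) by (intro mult_left_mono) auto
    finally show "int k + 1 \<le> int (CARD('p) ^ k) * d" .
  qed
  obtain L where L: "(\<lambda>k. \<Sum>i<k. f ^ (CARD('p) ^ i)) \<longlonglongrightarrow> L"
      "\<And>k. order_ge (int k + 1) (L - (\<Sum>i<k. f ^ (CARD('p) ^ i)))"
    by (rule fls_converges[of "\<lambda>k. \<Sum>i<k. f ^ (CARD('p) ^ i)"]) (use ok in auto)
  then have s: "(\<lambda>k. f ^ (CARD('p) ^ k)) sums L" by (simp add: sums_def)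
  then show "(\<lambda>k. f ^ (CARD('p) ^ k)) sums sigma f"
    unfolding sigma_def by (simp add: sums_iff)
  have "order_ge d (\<Sum>i<k. f ^ (CARD('p) ^ i))" for k
    by (induction k) (use od in \<open>auto intro!: order_ge_add\<close>)
  then have "order_ge d ((L - (\<Sum>i<nat d. f ^ (CARD('p) ^ i))) + (\<Sum>i<nat d. f ^ (CARD('p) ^ i)))"
    using L(2)[of "nat d"] by (intro order_ge_add) (auto elim!: order_ge_mono)
  then show "order_ge d (sigma f)"
    using s unfolding sigma_def by (simp add: sums_iff)
qed

lemma gR_order: "order_ge (int (CARD('p) ^ i)) (gR i :: 'p::prime_card Rp)"
proof (induction i)
  case 0
  have "order_ge 1 (fls_X :: 'p Rp)" by (auto simp: order_ge_def)
  then show ?case by (simp add: sigma_converges(2))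
next
  case (Suc i)
  have p: "CARD('p) \<ge> 2" using prime_card[where 'a='p] by (rule prime_ge_2_nat)
  have "order_ge (int CARD('p) * int (CARD('p) ^ i) + 0) (gR i ^ CARD('p) * zR i :: 'p Rp)"
    by (intro order_ge_mult order_ge_power Suc) (simp add: zR_def)
  then have "order_ge (int (CARD('p) ^ Suc i)) (gR i ^ CARD('p) * zR i :: 'p Rp)" by simp
  moreover have "int (CARD('p) ^ Suc i) \<ge> 1" using p by (simp add: Suc_le_eq flip: of_nat_power of_nat_mult)
  ultimately show ?case unfolding gR.simps by (rule sigma_converges(2))
qed

lemma H_eval_order:
  fixes f :: "'p::prime_card Rp"
  assumes "order_ge d f" "d \<ge> 0"
  shows "order_ge d (H_eval f - 1)"
proof -
  have f0: "order_ge 0 f" using assms by (rule order_ge_mono)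
  have ev: "order_ge 0 (poly (map_poly scal Q) f)" for Q :: "'p mod_ring poly"
  proof (induction Q)
    case (pCons a Q)
    have "map_poly scal (pCons a Q) = pCons (scal a) (map_poly scal Q)"
      by (rule map_poly_pCons) (use pCons in \<open>auto simp: scal_def\<close>)
    moreover have "order_ge 0 (scal a)" by (simp add: scal_def)
    ultimately show ?case using order_ge_mult[OF f0 pCons(2)] by (auto intro!: order_ge_add)
  qed simp
  obtain a Q where H: "(Hpoly :: 'p mod_ring poly) = pCons a Q" by (rule pCons_cases)
  have "poly (Hpoly :: 'p mod_ring poly) 0 = 1"
    unfolding Hpoly_def poly_prod by (rule prod.neutral) simp
  then have a: "a = 1" unfolding H by simp
  then have "H_eval f = 1 + f * poly (map_poly scal Q) f"
    by (simp add: H_eval_def H map_poly_pCons scal_def)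
  then show ?thesis using order_ge_mult[OF assms(1) ev] by simp
qed

lemma exp_tilde_has_prod:
  "(\<lambda>i. H_eval ((-1) ^ i * gR i)) has_prod (exp_tilde :: 'p::prime_card Rp)"
proof -
  define h where "h = (\<lambda>i. H_eval ((-1) ^ i * gR i) :: 'p Rp)"
  have p: "CARD('p) \<ge> 2" using prime_card[where 'a='p] by (rule prime_ge_2_nat)
  have h: "order_ge (int i + 1) (h i - 1)" for i
  proof -
    have "i < 2 ^ i" by (rule less_exp)
    also have "(2::nat) ^ i \<le> CARD('p) ^ i" using p by (rule power_mono) auto
    finally have "int i + 1 \<le> int (CARD('p) ^ i)" by linarith
    then have *: "order_ge (int i + 1) (gR i :: 'p Rp)"
      using gR_order by (rule order_ge_mono[rotated])
    have "order_ge 0 ((-1) ^ i :: 'p Rp)" 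
      by (cases "even i") (auto simp: order_ge_def)
    from order_ge_mult[OF this *] show ?thesis
      unfolding h_def by (intro H_eval_order) auto
  qed
  have h0: "order_ge 0 (h i)" for i
    using order_ge_add[OF order_ge_mono[OF h] order_ge_1, of i] by simp
  have P0: "order_ge 0 (\<Prod>i<k. h i)" for k
  proof (induction k)
    case (Suc k)
    then show ?case using order_ge_mult[OF Suc h0[of k]] by simp
  qed simp
  obtain L where L: "(\<lambda>k. \<Prod>i<k. h i) \<longlonglongrightarrow> L" "\<And>k. order_ge (int k + 1) (L - (\<Prod>i<k. h i))"
  proof (rule fls_converges[of "\<lambda>k. \<Prod>i<k. h i"])
    show "order_ge (int k + 1) ((\<Prod>i<Suc k. h i) - (\<Prod>i<k. h i))" for k
      using order_ge_mult[OF P0[of k] h[of k]] by (simp add: algebra_simps)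
  qed auto
  have "fls_nth (L - 1) 0 = 0" using L(2)[of 0] by (simp add: order_ge_def)
  then have "L \<noteq> 0" by auto
  with LIMSEQ_Suc[OF L(1)] have "raw_has_prod h 0 L"
    by (simp add: raw_has_prod_def lessThan_Suc_atMost)
  then have "h has_prod L" by (simp add: has_prod_def)
  then have "h has_prod prodinf h" using has_prod_unique by metis
  then show ?thesis by (simp add: exp_tilde_def h_def)
qed

end

theory Submission
  imports Defs
begin

text \<open>
  Write $p$ for the characteristic, $D_i = x z_1 \cdots z_i$, and let $v_0 = x$ and
  $v_{i+1} = g_i^p z_{i+1}$ be the arguments of $\sigma$, so that $g_i = \sigma(v_i)$.

  The differential equation is a telescoping sum of logarithmic derivatives.  Since Frobenius is
  additive and continuous, $g_i - g_i^p = v_i$ (\<open>sigma_Artin_Schreier\<close>).  As $p$-th powers are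
  constants for the derivation, this gives $g_i' = v_i'$, and $v_i' = v_i / D_i$ can be read off from
  the prescribed $z_i'$.  The polynomial $H$ satisfies $(1 - t^{p-1}) H' = H$
  (\<open>Hpoly_ODE\<close>), which becomes $t H(t) = (t - t^p) H'(t)$ and hence, at $t = \pm g_i$,
  where $t - t^p = \pm v_i$, shows that $H(\pm g_i)$ has the logarithmic derivative $\pm g_i / D_i$.
  For $i \ge 1$,
  $$g_i / D_i = (v_i + g_i^p) / D_i = g_{i-1}^p / D_{i-1} + g_i^p / D_i,$$
  while $g_0 / D_0 = 1 + g_0^p / D_0$.  The alternating sum up to $n$ is therefore
  $1 + (-1)^n g_n^p / D_n$ (\<open>Rp_deriv_partial_product\<close>), and the error term tends to $0$ because
  $g_n$ has order at least $p^n$ whereas $D_n$ has order $1$.  The derivation lowers orders by at most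
  one, so it is continuous and the limit satisfies the equation exactly.

  For membership in $\mathcal{S}_p$, let $u_k = x^{p^k} w_k$ be the generators.  They satisfy
  $u_0 = x$ and $u_{k+1} = u_k^p z_{k+1}$, the same recursion that produces $v_{i+1}$ from $g_i$.
  The series $\sigma(u t) = u \sum_k u^{p^k - 1} t^{p^k}$ shows that $\sigma$ preserves divisibility
  by $u$ in the closed subring $\mathcal{S}_p$ (\<open>sigma_multiple\<close>).  Hence by induction every
  $g_i$ is a multiple of $u_i$ in $\mathcal{S}_p$ (\<open>gR_multiple\<close>): if $g_i = u_i s$, then
  $v_{i+1} = u_{i+1} s^p$.
\<close>

section \<open>The $x$-adic topology in terms of orders\<close>

lemma order_ge_minus: "order_ge d f \<Longrightarrow> order_ge d (- f)"
  for f :: "'a::comm_ring_1 fls"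
  by (auto simp: order_ge_def)

lemma order_ge_diff: "order_ge d f \<Longrightarrow> order_ge d h \<Longrightarrow> order_ge d (f - h)"
  for f h :: "'a::comm_ring_1 fls"
  by (auto simp: order_ge_def)

lemma order_ge_swap: "order_ge d (f - h) \<Longrightarrow> order_ge d (h - f)"
  for f h :: "'a::comm_ring_1 fls"
  by (auto simp: order_ge_def)

lemma order_ge_trans: "order_ge d (f - g) \<Longrightarrow> order_ge d (g - h) \<Longrightarrow> order_ge d (f - h)"
  for f h :: "'a::comm_ring_1 fls"
  by (auto simp: order_ge_def)

lemma order_ge_all_imp_0:
  fixes f :: "'a::comm_ring_1 fls"
  assumes "\<And>k. order_ge (int k) f"
  shows "f = 0"
proof (rule fls_eqI)
  fix n
  show "fls_nth f n = fls_nth 0 n"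
    using assms[of "nat (n + 1)"] by (simp add: order_ge_def)
qed

lemma dist_le_of_order_ge:
  fixes f h :: "'a::comm_ring_1 fls"
  assumes "order_ge (int k) (f - h)"
  shows "dist f h \<le> inverse 2 ^ k"
proof (cases "f = h")
  case False
  have "int k \<le> fls_subdegree (f - h)"
    using assms False by (intro fls_subdegree_geI) (auto simp: order_ge_def)
  then have "0 \<le> fls_subdegree (f - h)" "k \<le> nat (fls_subdegree (f - h))" by auto
  moreover from this have "inverse (2 ^ nat (fls_subdegree (f - h))) \<le> (inverse (2 ^ k) :: real)"
    by (intro le_imp_inverse_le power_increasing) auto
  ultimately show ?thesis using False
    by (simp add: dist_fls_def power_one_over inverse_eq_divide)
qed simp

lemma order_ge_of_dist_less:
  fixes f h :: "'a::comm_ring_1 fls"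
  assumes "dist f h < inverse 2 ^ k"
  shows "order_ge (int k) (f - h)"
proof (rule ccontr)
  assume "\<not> order_ge (int k) (f - h)"
  then obtain n where n: "n < int k" "fls_nth (f - h) n \<noteq> 0" by (auto simp: order_ge_def)
  define s where "s = fls_subdegree (f - h)"
  have "s \<le> n" unfolding s_def by (rule fls_subdegree_leI[OF n(2)])
  with n(1) have s: "s < int k" by simp
  have neq: "f \<noteq> h" using n(2) by auto
  have "inverse 2 ^ k \<le> dist f h"
  proof (cases "s \<ge> 0")
    case True
    with s have "nat s \<le> k" by simp
    then have "inverse (2 ^ k) \<le> (inverse (2 ^ nat s) :: real)"
      by (intro le_imp_inverse_le power_increasing) auto
    then show ?thesis using True neq by (simp add: dist_fls_def s_def power_one_over inverse_eq_divide)
  next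
    case False
    have "inverse 2 ^ k \<le> (1::real)" by (rule power_le_one) auto
    also have "1 \<le> (2::real) ^ nat (- s)" by simp
    finally show ?thesis using False neq by (simp add: dist_fls_def s_def)
  qed
  with assms show False by simp
qed

lemma ex_inverse_two_power_less: "0 < e \<Longrightarrow> \<exists>k. inverse 2 ^ k < (e::real)"
  by (rule real_arch_pow_inv) auto

text \<open>
  With this criterion the ring structure of $\mathcal{S}_p$ needs only estimates of orders.
\<close>

lemma in_closure_fls_iff:
  fixes f :: "'a::comm_ring_1 fls"
  shows "f \<in> closure A \<longleftrightarrow> (\<forall>k::nat. \<exists>a\<in>A. order_ge (int k) (f - a))"
proof
  assume "f \<in> closure A"
  then have "\<exists>a\<in>A. dist a f < inverse 2 ^ k" for k :: nat
    by (simp add: closure_approachable)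
  then show "\<forall>k::nat. \<exists>a\<in>A. order_ge (int k) (f - a)"
    by (metis order_ge_of_dist_less dist_commute)
next
  assume *: "\<forall>k::nat. \<exists>a\<in>A. order_ge (int k) (f - a)"
  show "f \<in> closure A"
    unfolding closure_approachable
  proof (intro allI impI)
    fix e :: real
    assume "0 < e"
    then obtain k where "inverse 2 ^ k < e" using ex_inverse_two_power_less by blast
    moreover obtain a where "a \<in> A" "order_ge (int k) (f - a)" using * by blast
    ultimately show "\<exists>a\<in>A. dist a f < e"
      using dist_le_of_order_ge[of k f a] by (auto simp: dist_commute intro!: bexI[of _ a])
  qed
qed

lemma LIMSEQ_order_ge:
  fixes S :: "nat \<Rightarrow> 'a::comm_ring_1 fls"
  assumes "S \<longlonglongrightarrow> L"
  obtains N where "\<And>n. n \<ge> N \<Longrightarrow> order_ge (int k) (L - S n)"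
proof -
  have "eventually (\<lambda>n. dist (S n) L < inverse 2 ^ k) sequentially"
    using assms by (rule tendstoD) simp
  then obtain N where "\<And>n. n \<ge> N \<Longrightarrow> dist (S n) L < inverse 2 ^ k"
    by (auto simp: eventually_sequentially)
  then show ?thesis
    by (metis that order_ge_of_dist_less dist_commute)
qed

section \<open>Constants and the Frobenius endomorphism\<close>

interpretation scal: comm_ring_hom "scal :: 'p::prime_card mod_ring \<Rightarrow> 'p Rp"
  by unfold_locales
     (simp_all add: scal_def single_add fls_plus_const mult_single flip: to_fract_mult)

interpretation map_poly_scal: map_poly_comm_ring_hom "scal :: 'p::prime_card mod_ring \<Rightarrow> 'p Rp" ..

lemma order_ge_scal: "order_ge 0 (scal c)"
  by (simp add: scal_def)

lemma CARD_ge_2: "CARD('p::prime_card) \<ge> 2"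
  using prime_card[where 'a='p] by (rule prime_ge_2_nat)

lemma CHAR_Rp: "CHAR('p::prime_card Rp) = CARD('p)"
proof -
  have "of_nat CARD('p) = (scal (of_nat CARD('p)) :: 'p Rp)" by (simp only: scal.hom_of_nat)
  then have "of_nat CARD('p) = (0 :: 'p Rp)" by simp
  then have "CHAR('p Rp) dvd CARD('p)" by (simp only: of_nat_eq_0_iff_char_dvd)
  moreover have "CHAR('p Rp) \<noteq> 1" by simp
  ultimately show ?thesis using prime_card[where 'a='p] by (auto simp: prime_nat_iff)
qed

lemma of_nat_CARD_Rp: "of_nat CARD('p) = (0 :: 'p::prime_card Rp)"
  by (metis CHAR_Rp of_nat_CHAR)

lemma Frobenius_add: "(f + h) ^ CARD('p) = f ^ CARD('p) + h ^ CARD('p)"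
  for f h :: "'p::prime_card Rp"
  by (rule freshmans_dream) (simp_all only: CHAR_Rp prime_card)

lemma Frobenius_diff: "(f - h) ^ CARD('p) = f ^ CARD('p) - h ^ CARD('p)"
  for f h :: "'p::prime_card Rp"
  using Frobenius_add[of "f - h" h] by simp

lemma Frobenius_minus: "(- f) ^ CARD('p) = - (f ^ CARD('p))"
  for f :: "'p::prime_card Rp"
  using Frobenius_diff[of 0 f] CARD_ge_2[where 'p='p] by (simp add: power_0_left)

lemma Frobenius_sum: "(\<Sum>i\<in>A. F i) ^ CARD('p) = (\<Sum>i\<in>A. F i ^ CARD('p))"
  for F :: "'b \<Rightarrow> 'p::prime_card Rp"
  by (rule freshmans_dream_sum) (simp_all only: CHAR_Rp prime_card)

section \<open>Continuity of the derivation\<close>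

lemma Rp_deriv_diff: "Rp_deriv (f - h) = Rp_deriv f - Rp_deriv h"
  using Rp_deriv_add[of "f - h" h] by (simp add: algebra_simps)

lemma Rp_deriv_0 [simp]: "Rp_deriv 0 = 0"
  using Rp_deriv_diff[of 0 0] by simp

lemma Rp_deriv_1 [simp]: "Rp_deriv 1 = 0"
  using Rp_deriv_scal[of 1] by simp

lemma Rp_deriv_minus: "Rp_deriv (- f) = - Rp_deriv f"
  using Rp_deriv_diff[of 0 f] by simp

lemma Rp_deriv_power: "Rp_deriv (f ^ n) = of_nat n * f ^ (n - 1) * Rp_deriv f"
proof (induction n)
  case (Suc n)
  show ?case
  proof (cases n)
    case (Suc m)
    then show ?thesis using Suc.IH by (simp add: Rp_deriv_mult algebra_simps)
  qed simp
qed simp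

lemma Rp_deriv_Frobenius: "Rp_deriv (f ^ CARD('p)) = 0"
  for f :: "'p::prime_card Rp"
  by (simp add: Rp_deriv_power of_nat_CARD_Rp)

lemma order_ge_X_inv: "order_ge (- 1) (fls_X_inv :: 'a::comm_ring_1 fls)"
  by (simp add: order_ge_def)

lemma order_ge_Rp_deriv:
  assumes "order_ge d f"
  shows "order_ge (d - 1) (Rp_deriv f)"
proof -
  have "order_ge d (coeff_delta f)" using assms by (auto simp: order_ge_def)
  from order_ge_mult[OF order_ge_X_inv this]
  have "order_ge (d - 1) (fls_X_inv * coeff_delta f)" by simp
  moreover have "order_ge (d - 1) (fls_deriv f)" using assms by (auto simp: order_ge_def)
  ultimately show ?thesis unfolding Rp_deriv_def by (rule order_ge_add)
qed

section \<open>The Artin--Schreier equation for $\sigma$\<close>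

text \<open>
  Frobenius shifts the partial sums of \<open>\<sigma>\<close>: the $p$-th power of the sum of $n$ terms is the sum
  of $n + 1$ terms without $f$.
\<close>

lemma sigma_Artin_Schreier:
  fixes f :: "'p::prime_card Rp"
  assumes "order_ge 1 f"
  shows "sigma f - sigma f ^ CARD('p) = f"
proof -
  define s where "s = (\<lambda>n. \<Sum>k<n. f ^ (CARD('p) ^ k))"
  have lim: "s \<longlonglongrightarrow> sigma f"
    using sigma_converges(1)[OF assms] by (simp add: sums_def s_def)
  have step: "s n ^ CARD('p) = s (Suc n) - f" for n
  proof -
    have "s n ^ CARD('p) = (\<Sum>k<n. f ^ (CARD('p) ^ Suc k))"
      unfolding s_def Frobenius_sum
      by (rule sum.cong) (simp_all flip: power_mult add: mult.commute)
    also have "\<dots> = s (Suc n) - f"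
      unfolding s_def sum.lessThan_Suc_shift by simp
    finally show ?thesis .
  qed
  have "order_ge (int k) (sigma f - sigma f ^ CARD('p) - f)" for k
  proof -
    obtain N where N: "\<And>n. n \<ge> N \<Longrightarrow> order_ge (int k) (sigma f - s n)"
      using LIMSEQ_order_ge[OF lim] by metis
    have "order_ge (int CARD('p) * int k) ((sigma f - s N) ^ CARD('p))"
      using N by (intro order_ge_power) simp
    then have "order_ge (int k) ((sigma f - s N) ^ CARD('p))"
      by (rule order_ge_mono) (use CARD_ge_2[where 'p='p] mult_right_mono[of 1 "int CARD('p)" "int k"] in simp)
    moreover have "order_ge (int k) (sigma f - s (Suc N))" using N by simp
    ultimately have "order_ge (int k) ((sigma f - s (Suc N)) - (sigma f - s N) ^ CARD('p))"
      by (rule order_ge_diff[rotated])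
    \<comment> \<open>The last difference is $\sigma(f) - \sigma(f)^p - f$: by \<open>step\<close> the partial sums cancel.\<close>
    then show ?thesis by (simp add: Frobenius_diff step algebra_simps)
  qed
  then have "sigma f - sigma f ^ CARD('p) - f = 0" by (rule order_ge_all_imp_0)
  then show ?thesis by simp
qed

lemma Rp_deriv_sigma:
  fixes f :: "'p::prime_card Rp"
  assumes "order_ge 1 f"
  shows "Rp_deriv (sigma f) = Rp_deriv f"
proof -
  have "Rp_deriv f = Rp_deriv (sigma f - sigma f ^ CARD('p))"
    by (simp only: sigma_Artin_Schreier[OF assms])
  then show ?thesis by (simp add: Rp_deriv_diff Rp_deriv_Frobenius)
qed

section \<open>The differential equation of $H$\<close>

text \<open>
  Both sides have degree less than $p$ and agree on the $p$ elements of the prime field: they are $1$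
  at $0$ and vanish elsewhere, the right side by Fermat's little theorem.
\<close>

lemma prod_linear_factors:
  "(\<Prod>k = 1..<CARD('p). [:1, - (1 / of_nat k):]) = 1 - Polynomial.monom (1 :: 'p::prime_card mod_ring) (CARD('p) - 1)"
  (is "?Q = ?R")
proof -
  have p: "CARD('p) \<ge> 2" by (rule CARD_ge_2)
  have "poly ?Q a = poly ?R a" for a :: "'p mod_ring"
  proof -
    obtain i where i: "i < CARD('p)" "a = of_nat i" using surj_of_nat_mod_ring by blast
    show ?thesis
    proof (cases "i = 0")
      case True
      then show ?thesis using p i by (simp add: poly_prod poly_monom power_0_left)
    next
      case False
      have nz: "a \<noteq> 0"
        using i False of_nat_0_mod_ring_dvd[where 'a='p, of i] dvd_imp_le[of "CARD('p)" i] by auto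
      have "poly ?Q a = 0"
        unfolding poly_prod
      proof (rule prod_zero)
        show "\<exists>k\<in>{1..<CARD('p)}. poly [:1, - (1 / of_nat k):] a = 0"
          using i False nz by (intro bexI[of _ i]) auto
      qed simp
      moreover have "a ^ (CARD('p) - 1) = 1"
      proof -
        have "\<not> CARD('p) dvd i" using i False dvd_imp_le[of "CARD('p)" i] by auto
        then have "[i ^ (CARD('p) - 1) = 1] (mod CARD('p))"
          by (rule fermat_theorem[OF prime_card])
        then have "of_nat (i ^ (CARD('p) - 1)) = (of_nat 1 :: 'p mod_ring)"
          by (simp only: of_nat_eq_iff_cong_CHAR semiring_char_mod_ring)
        then show ?thesis by (simp add: i(2))
      qed
      ultimately show ?thesis by (simp add: poly_monom)
    qed
  qed
  moreover have "degree (?Q - ?R) < CARD('p)"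
  proof -
    have "degree ?Q \<le> sum (degree \<circ> (\<lambda>k. [:1, - (1 / of_nat k :: 'p mod_ring):])) {1..<CARD('p)}"
      by (rule degree_prod_sum_le) simp
    also have "\<dots> \<le> (\<Sum>k = 1..<CARD('p). 1)"
      by (rule sum_mono) (simp add: degree_pCons_eq_if)
    finally have "degree ?Q \<le> CARD('p) - 1" by simp
    moreover have "degree ?R \<le> CARD('p) - 1"
      by (rule degree_diff_le) (auto simp: degree_monom_le)
    ultimately have "degree (?Q - ?R) \<le> CARD('p) - 1" by (rule degree_diff_le)
    then show ?thesis using p by simp
  qed
  ultimately have "?Q - ?R = 0"
    by (intro poly_eqI_degree[of UNIV]) (use p in auto)
  then show ?thesis by simp
qed

text \<open>
  The logarithmic derivative of $\prod_k (1 + c_k t)^k$, with the denominator $\prod_k (1 + c_k t)$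
  cleared.
\<close>

lemma pderiv_prod_powers:
  fixes c :: "nat \<Rightarrow> 'a::field"
  assumes "finite A"
  shows "(\<Prod>k\<in>A. [:1, c k:]) * pderiv (\<Prod>k\<in>A. [:1, c k:] ^ k) =
     (\<Prod>k\<in>A. [:1, c k:] ^ k) * (\<Sum>k\<in>A. Polynomial.smult (of_nat k * c k) (\<Prod>j\<in>A - {k}. [:1, c j:]))"
  using assms
proof (induction A rule: finite_induct)
  case (insert a A)
  define L where "L = [:1, c a:]"
  define P where "P = (\<Prod>k\<in>A. [:1, c k:])"
  define H where "H = (\<Prod>k\<in>A. [:1, c k:] ^ k)"
  define S where "S = (\<Sum>k\<in>A. Polynomial.smult (of_nat k * c k) (\<Prod>j\<in>A - {k}. [:1, c j:]))"
  have IH: "P * pderiv H = H * S" using insert.IH by (simp only: P_def H_def S_def)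
  have "insert a A - {k} = insert a (A - {k})" if "k \<in> A" for k
    using that insert by auto
  then have "(\<Prod>j\<in>insert a A - {k}. [:1, c j:]) = L * (\<Prod>j\<in>A - {k}. [:1, c j:])" if "k \<in> A" for k
    using that insert by (simp add: L_def)
  then have S': "(\<Sum>k\<in>insert a A. Polynomial.smult (of_nat k * c k) (\<Prod>j\<in>insert a A - {k}. [:1, c j:]))
      = Polynomial.smult (of_nat a * c a) P + L * S"
    using insert by (simp add: P_def S_def sum_distrib_left mult_smult_right)
  have L': "L * pderiv (L ^ a) = L ^ a * [:of_nat a * c a:]"
  proof (cases a)
    case (Suc m)
    have "pderiv L = [:c a:]" by (simp add: L_def pderiv_pCons)
    then show ?thesis unfolding Suc pderiv_power_Suc by (simp add: algebra_simps)
  qed simp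
  have "L * P * pderiv (L ^ a * H) = L ^ a * L * (P * pderiv H) + P * H * (L * pderiv (L ^ a))"
    by (simp add: pderiv_mult algebra_simps)
  also have "\<dots> = L ^ a * H * (Polynomial.smult (of_nat a * c a) P + L * S)"
    unfolding IH L' by (simp add: algebra_simps)
  finally show ?case
    unfolding S' using insert by (simp add: L_def P_def H_def)
qed simp

text \<open>
  Since $c_k t = (1 + c_k t) - 1$, multiplying the product rule by $t$ turns its $k$-th summand into
  the difference of the full product and the product without its $k$-th factor.  This
  expresses the sum of the latter products through the full product and its derivative.
\<close>

lemma pderiv_prod_linear:
  fixes c :: "nat \<Rightarrow> 'a::field"
  assumes "finite A"
  shows "[:0, 1:] * pderiv (\<Prod>k\<in>A. [:1, c k:]) =
     of_nat (card A) * (\<Prod>k\<in>A. [:1, c k:]) - (\<Sum>k\<in>A. \<Prod>j\<in>A - {k}. [:1, c j:])"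
proof -
  have "[:0, 1:] * pderiv (\<Prod>k\<in>A. [:1, c k:]) =
     (\<Sum>k\<in>A. [:0, 1:] * ((\<Prod>j\<in>A - {k}. [:1, c j:]) * [:c k:]))"
    by (simp add: pderiv_prod pderiv_pCons sum_distrib_left)
  also have "\<dots> = (\<Sum>k\<in>A. (\<Prod>j\<in>A. [:1, c j:]) - (\<Prod>j\<in>A - {k}. [:1, c j:]))"
  proof (rule sum.cong[OF refl])
    fix k assume "k \<in> A"
    then have e: "(\<Prod>j\<in>A. [:1, c j:]) = [:1, c k:] * (\<Prod>j\<in>A - {k}. [:1, c j:])"
      using assms by (simp only: prod.remove)
    have "[:0, 1:] * (R * [:c k:]) = [:1, c k:] * R - R" for R
      by (simp add: algebra_simps)
    then show "[:0, 1:] * ((\<Prod>j\<in>A - {k}. [:1, c j:]) * [:c k:]) =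
        (\<Prod>j\<in>A. [:1, c j:]) - (\<Prod>j\<in>A - {k}. [:1, c j:])"
      unfolding e .
  qed
  also have "\<dots> = of_nat (card A) * (\<Prod>k\<in>A. [:1, c k:]) - (\<Sum>k\<in>A. \<Prod>j\<in>A - {k}. [:1, c j:])"
    by (simp add: sum_subtractf)
  finally show ?thesis .
qed

text \<open>
  With $c_k = -1/k$ the weights $k c_k$ in \<open>pderiv_prod_powers\<close> are all $-1$, so the claim says that
  the products of all but one of the factors $1 - t/k$ add up to $-1$.  This follows from
  \<open>pderiv_prod_linear\<close>, because the full product is $1 - t^{p-1}$ and
  $t (1 - t^{p-1})' = t^{p-1}$ in characteristic $p$.
\<close>

lemma Hpoly_ODE:
  "(1 - Polynomial.monom 1 (CARD('p) - 1)) * pderiv Hpoly = (Hpoly :: 'p::prime_card mod_ring poly)"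
proof -
  let ?A = "{1..<CARD('p)}"
  define c :: "nat \<Rightarrow> 'p mod_ring" where "c k = - (1 / of_nat k)" for k
  define X where "X = Polynomial.monom (1 :: 'p mod_ring) (CARD('p) - 1)"
  define R where "R = (\<lambda>k. \<Prod>j\<in>?A - {k}. [:1, c j:])"
  have Q: "(\<Prod>k\<in>?A. [:1, c k:]) = 1 - X"
    using prod_linear_factors[where 'p='p] by (simp add: c_def X_def)
  have m1: "of_nat (CARD('p) - 1) = (- 1 :: 'p mod_ring)"
    using CARD_ge_2[where 'p='p] by (simp add: of_nat_diff)
  have "of_nat CARD('p) = (0 :: 'p mod_ring poly)" by (simp add: of_nat_poly)
  then have m1_poly: "of_nat (CARD('p) - 1) = (- 1 :: 'p mod_ring poly)"
    using CARD_ge_2[where 'p='p] by (simp add: of_nat_diff)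
  have "[:0, 1:] * pderiv (1 - X) = [:0, 1:] * Polynomial.monom 1 (CARD('p) - 1 - 1)"
    unfolding X_def by (simp add: pderiv_diff pderiv_monom m1 minus_monom)
  also have "\<dots> = X"
  proof -
    have "CARD('p) - 1 = Suc (CARD('p) - 1 - 1)" using CARD_ge_2[where 'p='p] by simp
    then obtain m where m: "CARD('p) - 1 = Suc m" by blast
    show ?thesis unfolding X_def m by (simp add: monom_Suc)
  qed
  finally have tX: "[:0, 1:] * pderiv (1 - X) = X" .
  have "X = - 1 * (1 - X) - (\<Sum>k\<in>?A. R k)"
    using pderiv_prod_linear[OF finite_atLeastLessThan, of c 1 "CARD('p)"]
    unfolding Q card_atLeastLessThan m1_poly tX R_def .
  then have "1 + (\<Sum>k\<in>?A. R k) = 0" by (simp add: algebra_simps)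
  then have S: "(\<Sum>k\<in>?A. R k) = - 1" by (rule add.inverse_unique[symmetric])
  have k: "of_nat k * c k = - 1" if "k \<in> ?A" for k
  proof -
    have "of_nat k \<noteq> (0 :: 'p mod_ring)"
      using that of_nat_0_mod_ring_dvd[where 'a='p, of k] dvd_imp_le[of "CARD('p)" k] by auto
    then show ?thesis by (simp add: c_def)
  qed
  have H: "Hpoly = (\<Prod>k\<in>?A. [:1, c k:] ^ k)" by (simp add: Hpoly_def c_def)
  have "(1 - X) * pderiv Hpoly = Hpoly * (\<Sum>k\<in>?A. Polynomial.smult (of_nat k * c k) (R k))"
    using pderiv_prod_powers[OF finite_atLeastLessThan, of c 1 "CARD('p)"]
    unfolding Q H R_def .
  also have "(\<Sum>k\<in>?A. Polynomial.smult (of_nat k * c k) (R k)) = (\<Sum>k\<in>?A. - R k)"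
    by (rule sum.cong) (simp_all only: k smult_minus_left smult_1_left)
  also have "\<dots> = 1" unfolding sum_negf S by simp
  finally show ?thesis by (simp add: X_def)
qed

text \<open>
  Multiplying by $y$ turns the coefficient $1 - y^{p-1}$ into $y - y^p$, which for
  $y = \pm g_i$ is known from the Artin--Schreier equation.
\<close>

lemma H_eval_ODE:
  "y * H_eval y = (y - y ^ CARD('p)) * poly (map_poly scal (pderiv Hpoly)) y"
  for y :: "'p::prime_card Rp"
proof -
  have "map_poly scal (Hpoly :: 'p mod_ring poly) =
      (1 - Polynomial.monom 1 (CARD('p) - 1)) * map_poly scal (pderiv Hpoly)"
    by (subst Hpoly_ODE[symmetric]) (simp add: map_poly_scal.hom_mult map_poly_scal.hom_minus map_poly_monom)
  then have "H_eval y = (1 - y ^ (CARD('p) - 1)) * poly (map_poly scal (pderiv Hpoly)) y"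
    by (simp add: H_eval_def poly_monom)
  moreover have "y * (1 - y ^ (CARD('p) - 1)) = y - y ^ CARD('p)"
    using CARD_ge_2[where 'p='p] by (simp add: algebra_simps flip: power_Suc)
  ultimately show ?thesis by (simp flip: mult.assoc)
qed

lemma Rp_deriv_poly:
  "Rp_deriv (poly (map_poly scal P) y) = poly (map_poly scal (pderiv P)) y * Rp_deriv y"
  for y :: "'p::prime_card Rp"
proof (induction P)
  case (pCons a P)
  have "map_poly scal (pCons b Q) = pCons (scal b) (map_poly scal Q)" for b :: "'p mod_ring" and Q
    by (simp add: map_poly_simps)
  then show ?case
    using pCons.IH
    by (simp add: pderiv_pCons Rp_deriv_add Rp_deriv_mult Rp_deriv_scal map_poly_scal.hom_add algebra_simps)
qed simp

section \<open>Differentiating the product\<close>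

text \<open>The arguments of \<open>\<sigma>\<close> in the recursion for $g_i$.\<close>

primrec vR :: "nat \<Rightarrow> 'p::prime_card Rp" where
  "vR 0 = fls_X"
| "vR (Suc i) = gR i ^ CARD('p) * zR i"

text \<open>
  The common denominator in the logarithmic derivatives of $v_i$ and of the factors of the product;
  it is also the reciprocal of $z_{i+1}'$.
\<close>

definition DR :: "nat \<Rightarrow> 'p::prime_card Rp" where
  "DR i = fls_X * (\<Prod>j<i. zR j)"

lemma gR_eq_sigma: "gR i = sigma (vR i)"
  by (cases i) simp_all

lemma order_ge_zR: "order_ge 0 (zR i)"
  by (simp add: zR_def)

lemma order_ge_vR: "order_ge 1 (vR i :: 'p::prime_card Rp)"
proof (cases i)
  case (Suc j)
  have "order_ge (int CARD('p) * int (CARD('p) ^ j) + 0) (gR j ^ CARD('p) * zR j :: 'p Rp)"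
    by (intro order_ge_mult order_ge_power gR_order order_ge_zR)
  then show ?thesis unfolding Suc vR.simps
    by (rule order_ge_mono) (use CARD_ge_2[where 'p='p] in \<open>simp flip: of_nat_mult of_nat_power power_Suc\<close>)
qed (simp add: order_ge_def)

lemma gR_Artin_Schreier: "gR i - gR i ^ CARD('p) = (vR i :: 'p::prime_card Rp)"
  unfolding gR_eq_sigma by (rule sigma_Artin_Schreier[OF order_ge_vR])

lemma zvar_nonzero: "zvar i \<noteq> (0 :: 'p::prime_card zfrac)"
proof -
  have "Poly_Mapping.single (Poly_Mapping.single i (1::nat)) (1 :: 'p mod_ring) \<noteq> 0"
    by (metis lookup_single_eq lookup_zero zero_neq_one)
  then show ?thesis by (simp add: zvar_def)
qed

lemma DR_eq: "DR i = fls_X * fls_const (\<Prod>j<i. zvar j)"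
proof -
  have "(\<Prod>j<i. zR j) = fls_const (\<Prod>j<i. zvar j)"
    by (induction i) (simp_all add: zR_def)
  then show ?thesis by (simp add: DR_def)
qed

lemma DR_nonzero: "DR i \<noteq> (0 :: 'p::prime_card Rp)"
  by (simp add: DR_eq zvar_nonzero)

lemma order_ge_inverse_DR: "order_ge (- 1) (inverse (DR i :: 'p::prime_card Rp))"
proof -
  have "inverse (DR i :: 'p Rp) = fls_X_inv * fls_const (inverse (\<Prod>j<i. zvar j))"
    by (simp add: DR_eq fls_inverse_X fls_inverse_const)
  then show ?thesis
    using order_ge_mult[OF order_ge_X_inv order_ge_const, of "inverse (\<Prod>j<i. zvar j) :: 'p zfrac"] by simp
qed

lemma DR_Suc: "DR (Suc i) = DR i * zR i"
  by (simp add: DR_def algebra_simps)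

lemma zR_nonzero: "zR i \<noteq> (0 :: 'p::prime_card Rp)"
  by (simp add: zR_def zvar_nonzero)

text \<open>
  In $v_{j+1} = g_j^p z_{j+1}$ the factor $g_j^p$ is a constant of the derivation, and
  $z_{j+1}' = 1 / D_j = z_{j+1} / D_{j+1}$.
\<close>

lemma Rp_deriv_vR: "Rp_deriv (vR i) = vR i / (DR i :: 'p::prime_card Rp)"
proof (cases i)
  case 0
  then show ?thesis by (simp add: Rp_deriv_X DR_def)
next
  case (Suc j)
  have "Rp_deriv (vR i) = gR j ^ CARD('p) / (DR j :: 'p Rp)"
    by (simp add: Suc Rp_deriv_mult Rp_deriv_Frobenius Rp_deriv_z DR_def)
  then show ?thesis by (simp add: Suc DR_Suc zR_nonzero)
qed

lemma Rp_deriv_gR: "Rp_deriv (gR i) = vR i / (DR i :: 'p::prime_card Rp)"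
  unfolding gR_eq_sigma by (simp add: Rp_deriv_sigma order_ge_vR Rp_deriv_vR)

text \<open>
  For $y = \pm g_i$ the derivative is $(y - y^p) / D_i$, since Frobenius commutes with the sign;
  then \<open>H_eval_ODE\<close> turns $(y - y^p) H'(y)$ into $y H(y)$.
\<close>

lemma Rp_deriv_factor:
  "Rp_deriv (H_eval ((-1) ^ i * gR i)) =
     H_eval ((-1) ^ i * gR i) * ((-1) ^ i * gR i / (DR i :: 'p::prime_card Rp))"
proof -
  define y :: "'p Rp" where "y = (-1) ^ i * gR i"
  have y: "y = gR i \<or> y = - gR i" by (cases "even i") (auto simp: y_def)
  then have "Rp_deriv y = (y - y ^ CARD('p)) / DR i"
    by (auto simp: Frobenius_minus Rp_deriv_minus Rp_deriv_gR minus_divide_left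
        simp flip: gR_Artin_Schreier)
  then have "Rp_deriv (H_eval y) = ((y - y ^ CARD('p)) * poly (map_poly scal (pderiv Hpoly)) y) / DR i"
    by (simp add: H_eval_def Rp_deriv_poly)
  also have "\<dots> = H_eval y * (y / DR i)"
    unfolding H_eval_ODE[symmetric] by simp
  finally show ?thesis by (simp add: y_def)
qed

text \<open>
  The telescoping step: $g_{n+1} / D_{n+1} = g_{n+1}^p / D_{n+1} + g_n^p / D_n$, and the
  alternating sign cancels the second term against the error of the previous partial product.
\<close>

lemma Rp_deriv_partial_product:
  "Rp_deriv (\<Prod>i\<le>n. H_eval ((-1) ^ i * gR i)) =
     (\<Prod>i\<le>n. H_eval ((-1) ^ i * gR i)) *
       (1 + (-1) ^ n * gR n ^ CARD('p) / (DR n :: 'p::prime_card Rp))"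
proof (induction n)
  case 0
  have "gR 0 = gR 0 ^ CARD('p) + (fls_X :: 'p Rp)"
    using gR_Artin_Schreier[of 0, where 'p='p] by (simp del: gR.simps add: algebra_simps)
  then have "gR 0 / DR 0 = 1 + gR 0 ^ CARD('p) / (DR 0 :: 'p Rp)"
    by (metis DR_def DR_nonzero add.commute add_divide_distrib divide_self lessThan_0
        mult.right_neutral prod.empty)
  then show ?case using Rp_deriv_factor[of 0, where 'p='p] by (simp del: gR.simps)
next
  case (Suc n)
  define P :: "'p Rp" where "P = (\<Prod>i\<le>n. H_eval ((-1) ^ i * gR i))"
  define h :: "'p Rp" where "h = H_eval ((-1) ^ Suc n * gR (Suc n))"
  define e :: "'p Rp" where "e = (-1) ^ n"
  define D :: "'p Rp" where "D = DR (Suc n)"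
  define G :: "'p Rp" where "G = gR (Suc n)"
  have AS: "G = G ^ CARD('p) + gR n ^ CARD('p) * zR n"
    using gR_Artin_Schreier[of "Suc n", where 'p='p] unfolding G_def
    by (simp del: gR.simps add: algebra_simps)
  have "G / D = G ^ CARD('p) / D + gR n ^ CARD('p) / DR n"
    by (subst AS) (simp only: add_divide_distrib D_def DR_Suc, simp add: zR_nonzero)
  then have "- e * (G / D) = - e * (G ^ CARD('p) / D + gR n ^ CARD('p) / DR n)"
    by (simp only:)
  then have G: "- e * G / D = - e * G ^ CARD('p) / D - e * gR n ^ CARD('p) / DR n"
    by (simp add: algebra_simps)
  have "Rp_deriv (P * h) = P * (1 + e * gR n ^ CARD('p) / DR n) * h + P * (h * (- e * G / D))"
    using Suc.IH Rp_deriv_factor[of "Suc n", where 'p='p]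
    by (simp only: Rp_deriv_mult P_def h_def e_def G_def D_def power_Suc mult_minus1)
  also have "\<dots> = P * h * (1 + - e * G ^ CARD('p) / D)"
    unfolding G by (simp add: algebra_simps)
  finally show ?case by (simp add: P_def h_def e_def G_def D_def del: gR.simps)
qed

section \<open>Membership in the closed subring\<close>

text \<open>
  The generators of the dense subalgebra of $\mathcal{S}_p$, with $x$ as $u_0$.
\<close>

definition uR :: "nat \<Rightarrow> 'p::prime_card Rp" where
  "uR k = fls_X ^ (CARD('p) ^ k) * wR k"

lemma uR_0: "uR 0 = fls_X"
  by (simp add: uR_def wR_def)

text \<open>
  The recursion of the generators has the same form as \<open>vR (Suc i)\<close>; this is what makes the
  inductive proof of \<open>gR_multiple\<close> work.
\<close>

lemma uR_Suc: "uR (Suc k) = uR k ^ CARD('p) * (zR k :: 'p::prime_card Rp)"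
proof -
  have "(\<Prod>j<k. zR j ^ (CARD('p) ^ (k - 1 - j)) :: 'p Rp) ^ CARD('p) =
      (\<Prod>j<k. zR j ^ (CARD('p) ^ (k - j)))"
    unfolding prod_power_distrib
  proof (rule prod.cong[OF refl])
    fix j assume "j \<in> {..<k}"
    then have "k - j = Suc (k - 1 - j)" by simp
    then show "(zR j ^ (CARD('p) ^ (k - 1 - j)) :: 'p Rp) ^ CARD('p) = zR j ^ (CARD('p) ^ (k - j))"
      by (simp flip: power_mult add: mult.commute)
  qed
  then show ?thesis
    by (simp add: uR_def wR_def power_mult_distrib mult.assoc mult.commute[of "CARD('p)"] flip: power_mult)
qed

lemma order_ge_X: "order_ge 1 (fls_X :: 'a::comm_ring_1 fls)"
  by (auto simp: order_ge_def)

lemma order_ge_uR: "order_ge 1 (uR k :: 'p::prime_card Rp)"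
proof (induction k)
  case 0
  then show ?case by (simp add: uR_0 order_ge_X)
next
  case (Suc k)
  have "order_ge (int CARD('p) * 1 + 0) (uR k ^ CARD('p) * zR k :: 'p Rp)"
    by (intro order_ge_mult order_ge_power Suc order_ge_zR)
  then show ?case unfolding uR_Suc
    by (rule order_ge_mono) (use CARD_ge_2[where 'p='p] in simp)
qed

lemma Sp_eq_closure: "Sp = closure (Fp_algebra (range (uR :: nat \<Rightarrow> 'p::prime_card Rp)))"
proof -
  have "insert fls_X {fls_X ^ (CARD('p) ^ k) * wR k | k. 1 \<le> k} = range (uR :: nat \<Rightarrow> 'p Rp)"
  proof -
    have "range (uR :: nat \<Rightarrow> 'p Rp) = insert (uR 0) {uR k | k. 1 \<le> k}"
      by (auto simp: Suc_le_eq) (metis neq0_conv)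
    then have "range (uR :: nat \<Rightarrow> 'p Rp) = insert fls_X {uR k | k. 1 \<le> k}"
      by (simp only: uR_0)
    then show ?thesis by (simp only: uR_def)
  qed
  then show ?thesis by (simp only: Sp_def)
qed

lemma Sp_iff:
  "f \<in> Sp \<longleftrightarrow> (\<forall>k::nat. \<exists>a\<in>Fp_algebra (range uR). order_ge (int k) (f - a))"
  for f :: "'p::prime_card Rp"
  unfolding Sp_eq_closure by (rule in_closure_fls_iff)

lemma order_ge_Fp_algebra: "f \<in> Fp_algebra (range uR) \<Longrightarrow> order_ge 0 f"
proof (induction rule: Fp_algebra.induct)
  case (gen g)
  then obtain k where "g = uR k" by blast
  then show ?case using order_ge_mono[OF order_ge_uR[of k], of 0] by simp
next
  case (mult f g)
  then show ?case using order_ge_mult[of 0 f 0 g] by simp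
qed (simp_all add: order_ge_scal order_ge_add)

lemma order_ge_Sp:
  assumes "f \<in> Sp"
  shows "order_ge 0 f"
proof -
  obtain a where a: "a \<in> Fp_algebra (range uR)" "order_ge 0 (f - a)"
    using assms unfolding Sp_iff by (metis of_nat_0)
  from order_ge_add[OF a(2) order_ge_Fp_algebra[OF a(1)]] show ?thesis by simp
qed

lemma Sp_base: "f \<in> Fp_algebra (range uR) \<Longrightarrow> f \<in> Sp"
  unfolding Sp_eq_closure by (rule closure_subset[THEN subsetD])

lemma Sp_scal: "scal c \<in> Sp"
  by (rule Sp_base[OF Fp_algebra.scal])

lemma Sp_uR: "uR k \<in> Sp"
  by (rule Sp_base[OF Fp_algebra.gen]) simp

lemma Sp_add:
  assumes "f \<in> Sp" "h \<in> Sp"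
  shows "f + h \<in> Sp"
  unfolding Sp_iff
proof
  fix k :: nat
  obtain a b where "a \<in> Fp_algebra (range uR)" "order_ge (int k) (f - a)"
    "b \<in> Fp_algebra (range uR)" "order_ge (int k) (h - b)"
    using assms unfolding Sp_iff by metis
  then show "\<exists>a\<in>Fp_algebra (range uR). order_ge (int k) (f + h - a)"
    using order_ge_add[of "int k" "f - a" "h - b"]
    by (intro bexI[of _ "a + b"]) (auto simp: algebra_simps intro: Fp_algebra.add)
qed

text \<open>
  Elements of $\mathcal{S}_p$ have nonnegative order, so multiplying by them does not spoil an
  approximation.
\<close>

lemma Sp_mult:
  assumes "f \<in> Sp" "h \<in> Sp"
  shows "f * h \<in> Sp"
  unfolding Sp_iff
proof
  fix k :: nat
  obtain a b where ab: "a \<in> Fp_algebra (range uR)" "order_ge (int k) (f - a)"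
    "b \<in> Fp_algebra (range uR)" "order_ge (int k) (h - b)"
    using assms unfolding Sp_iff by metis
  have "order_ge (int k + 0) ((f - a) * h)" "order_ge (0 + int k) (a * (h - b))"
    by (intro order_ge_mult order_ge_Sp order_ge_Fp_algebra ab assms)+
  then have "order_ge (int k) ((f - a) * h + a * (h - b))" by (intro order_ge_add) simp_all
  also have "(f - a) * h + a * (h - b) = f * h - a * b" by (simp add: algebra_simps)
  finally show "\<exists>a\<in>Fp_algebra (range uR). order_ge (int k) (f * h - a)"
    using ab by (intro bexI[of _ "a * b"]) (auto intro: Fp_algebra.mult)
qed

lemma Sp_0: "0 \<in> Sp" and Sp_1: "1 \<in> Sp"
  using Sp_scal[of 0] Sp_scal[of 1] by simp_all

lemma Sp_minus: "f \<in> Sp \<Longrightarrow> - f \<in> Sp"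
  using Sp_mult[OF Sp_scal[of "-1"]] by (simp add: scal.hom_uminus)

lemma Sp_power: "f \<in> Sp \<Longrightarrow> f ^ n \<in> Sp"
  by (induction n) (simp_all add: Sp_1 Sp_mult)

lemma Sp_sum: "(\<And>i. i \<in> A \<Longrightarrow> F i \<in> Sp) \<Longrightarrow> sum F A \<in> Sp"
  by (induction A rule: infinite_finite_induct) (simp_all add: Sp_0 Sp_add)

lemma Sp_prod: "(\<And>i. i \<in> A \<Longrightarrow> F i \<in> Sp) \<Longrightarrow> prod F A \<in> Sp"
  by (induction A rule: infinite_finite_induct) (simp_all add: Sp_1 Sp_mult)

lemma Sp_limit:
  assumes "S \<longlonglongrightarrow> f" "\<And>n. S n \<in> Sp"
  shows "f \<in> Sp"
proof -
  have "closed (Sp :: 'a Rp set)" unfolding Sp_def by simp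
  then show ?thesis using assms unfolding closed_sequential_limits by blast
qed

lemma Sp_H_eval:
  assumes "f \<in> Sp"
  shows "H_eval f \<in> Sp"
proof -
  have "poly (map_poly scal P) f \<in> Sp" for P
    by (induction P) (simp_all add: map_poly_pCons Sp_0 Sp_add Sp_mult Sp_scal assms)
  then show ?thesis by (simp add: H_eval_def)
qed

text \<open>
  Factor $u$ out of every term of \<open>\<sigma>\<close>: the cofactor $\sum_k u^{p^k - 1} t^{p^k}$ still converges,
  because $p^k - 1$ is unbounded, and its limit lies in the closed set $\mathcal{S}_p$.
\<close>

lemma sigma_multiple:
  fixes u :: "'p::prime_card Rp"
  assumes u: "u \<in> Sp" "order_ge 1 u" and t: "t \<in> Sp"
  obtains s where "s \<in> Sp" "sigma (u * t) = u * s"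
proof -
  define F where "F = (\<lambda>k. u ^ (CARD('p) ^ k - 1) * t ^ (CARD('p) ^ k))"
  have p: "CARD('p) \<ge> 2" by (rule CARD_ge_2)
  have F: "u * F k = (u * t) ^ (CARD('p) ^ k)" for k
  proof -
    have "CARD('p) ^ k = Suc (CARD('p) ^ k - 1)" using p by simp
    then have "u * u ^ (CARD('p) ^ k - 1) = u ^ (CARD('p) ^ k)" by (metis power_Suc)
    then show ?thesis by (simp add: F_def power_mult_distrib flip: mult.assoc)
  qed
  \<comment> \<open>The term with index 0 is $t$, whose order may be 0, so the bound starts with index 1.\<close>
  have "order_ge (int k + 1) (F (Suc k))" for k
  proof (rule order_ge_mono)
    show "order_ge (int (CARD('p) ^ Suc k - 1) * 1 + int (CARD('p) ^ Suc k) * 0) (F (Suc k))"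
      unfolding F_def by (intro order_ge_mult order_ge_power u order_ge_Sp t)
    have "Suc k < 2 ^ Suc k" by (rule less_exp)
    also have "(2::nat) ^ Suc k \<le> CARD('p) ^ Suc k" using p by (rule power_mono) simp
    finally show "int k + 1 \<le> int (CARD('p) ^ Suc k - 1) * 1 + int (CARD('p) ^ Suc k) * 0"
      by linarith
  qed
  then obtain s where s: "(\<lambda>n. \<Sum>k<Suc n. F k) \<longlonglongrightarrow> s"
    by (rule_tac fls_converges[of "\<lambda>n. \<Sum>k<Suc n. F k"]) auto
  have FS: "F k \<in> Sp" for k by (simp add: F_def Sp_mult Sp_power u t)
  have "s \<in> Sp" by (rule Sp_limit[OF s]) (simp add: Sp_sum FS del: sum.lessThan_Suc)
  moreover have "sigma (u * t) - u * s = 0"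
  proof (rule order_ge_all_imp_0)
    fix k
    have "order_ge (1 + 0) (u * t)" using u t by (intro order_ge_mult order_ge_Sp)
    then have "order_ge 1 (u * t)" by simp
    then have "(\<lambda>n. \<Sum>k<n. (u * t) ^ (CARD('p) ^ k)) \<longlonglongrightarrow> sigma (u * t)"
      using sigma_converges(1) by (auto simp: sums_def)
    then obtain N where N: "\<And>n. n \<ge> N \<Longrightarrow>
        order_ge (int k) (sigma (u * t) - (\<Sum>k<n. (u * t) ^ (CARD('p) ^ k)))"
      using LIMSEQ_order_ge by metis
    obtain M where M: "\<And>n. n \<ge> M \<Longrightarrow> order_ge (int k) (s - (\<Sum>k<Suc n. F k))"
      using LIMSEQ_order_ge[OF s] by metis
    define n where "n = max M N"
    have "order_ge (0 + int k) (u * (s - (\<Sum>k<Suc n. F k)))"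
      by (intro order_ge_mult order_ge_Sp u M) (simp add: n_def)
    moreover have "u * (s - (\<Sum>k<Suc n. F k)) = u * s - (\<Sum>k<Suc n. (u * t) ^ (CARD('p) ^ k))"
      by (simp only: right_diff_distrib sum_distrib_left F)
    ultimately have a: "order_ge (int k) (u * s - (\<Sum>k<Suc n. (u * t) ^ (CARD('p) ^ k)))" by simp
    have b: "order_ge (int k) (sigma (u * t) - (\<Sum>k<Suc n. (u * t) ^ (CARD('p) ^ k)))"
      by (rule N) (simp add: n_def)
    show "order_ge (int k) (sigma (u * t) - u * s)"
      by (rule order_ge_trans[OF b order_ge_swap[OF a]])
  qed
  ultimately show ?thesis using that[of s] by simp
qed

lemma gR_multiple: "\<exists>s\<in>Sp. gR i = uR i * (s :: 'p::prime_card Rp)"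
proof (induction i)
  case 0
  obtain s :: "'p Rp" where "s \<in> Sp" "sigma (uR 0 * 1) = uR 0 * s"
    using sigma_multiple[OF Sp_uR order_ge_uR Sp_1] by metis
  then show ?case by (auto simp: uR_0)
next
  case (Suc i)
  then obtain s :: "'p Rp" where s: "s \<in> Sp" "gR i = uR i * s" by blast
  obtain r :: "'p Rp" where "r \<in> Sp" "sigma (uR (Suc i) * s ^ CARD('p)) = uR (Suc i) * r"
    using sigma_multiple[OF Sp_uR order_ge_uR Sp_power[OF s(1)]] by metis
  moreover have "gR i ^ CARD('p) * zR i = uR (Suc i) * s ^ CARD('p)"
    by (simp add: s(2) uR_Suc power_mult_distrib algebra_simps)
  ultimately show ?case by (auto simp: algebra_simps)
qed

lemma Sp_gR: "gR i \<in> Sp"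
  using gR_multiple[of i] Sp_mult[OF Sp_uR] by metis

section \<open>The infinite product\<close>

text \<open>
  Every factor is $1$ plus a series of positive order and therefore nonzero, which excludes the case
  of a product that is $0$ because of a vanishing factor.
\<close>

lemma exp_tilde_LIMSEQ:
  "(\<lambda>n. \<Prod>i\<le>n. H_eval ((-1) ^ i * gR i)) \<longlonglongrightarrow> (exp_tilde :: 'p::prime_card Rp)"
proof -
  have "H_eval ((-1) ^ i * gR i) \<noteq> (0 :: 'p Rp)" for i
  proof -
    have "order_ge 1 (gR i :: 'p Rp)"
      using gR_order by (rule order_ge_mono) (use CARD_ge_2[where 'p='p] in simp)
    then have "order_ge 1 ((-1) ^ i * gR i :: 'p Rp)"
      by (cases "even i") (auto intro: order_ge_minus)
    from H_eval_order[OF this] have "fls_nth (H_eval ((-1) ^ i * gR i :: 'p Rp) - 1) 0 = 0"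
      by (simp add: order_ge_def)
    then show ?thesis by auto
  qed
  then show ?thesis
    using exp_tilde_has_prod[where 'p='p] by (auto simp: has_prod_def raw_has_prod_def)
qed

theorem theorem3p5:
  shows "(exp_tilde :: 'p::prime_card Rp) \<in> Sp \<and> Rp_deriv (exp_tilde :: 'p Rp) = exp_tilde"
proof
  define P :: "nat \<Rightarrow> 'p Rp" where "P n = (\<Prod>i\<le>n. H_eval ((-1) ^ i * gR i))" for n
  have lim: "P \<longlonglongrightarrow> exp_tilde" unfolding P_def by (rule exp_tilde_LIMSEQ)
  have "H_eval ((-1) ^ i * gR i :: 'p Rp) \<in> Sp" for i
    by (intro Sp_H_eval Sp_mult Sp_power Sp_minus Sp_1 Sp_gR)
  then have PS: "P n \<in> Sp" for n unfolding P_def by (rule Sp_prod)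
  show "(exp_tilde :: 'p Rp) \<in> Sp" by (rule Sp_limit[OF lim PS])
  have "Rp_deriv exp_tilde - (exp_tilde :: 'p Rp) = 0"
  proof (rule order_ge_all_imp_0)
    fix k
    obtain N where N: "\<And>n. n \<ge> N \<Longrightarrow> order_ge (int (Suc k)) (exp_tilde - P n)"
      using LIMSEQ_order_ge[OF lim] by metis
    define n where "n = max N (Suc k)"
    have o: "order_ge (int (Suc k)) (exp_tilde - P n)" by (rule N) (simp add: n_def)
    \<comment> \<open>The approximation has order one more than needed, as the derivation may lower it by one.\<close>
    have a: "order_ge (int k) (Rp_deriv exp_tilde - Rp_deriv (P n))"
      using order_ge_Rp_deriv[OF o] by (simp add: Rp_deriv_diff)
    have b: "order_ge (int k) (P n - exp_tilde)"
      by (rule order_ge_swap[OF order_ge_mono[OF o]]) simp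
    have "Rp_deriv (P n) - P n = P n * ((-1) ^ n * (gR n ^ CARD('p) * inverse (DR n)))"
      unfolding P_def Rp_deriv_partial_product by (simp add: algebra_simps divide_inverse)
    moreover have "order_ge (0 + (0 + (int CARD('p) * int (CARD('p) ^ n) + - 1)))
        (P n * ((-1) ^ n * (gR n ^ CARD('p) * inverse (DR n))))"
      by (intro order_ge_mult order_ge_power gR_order order_ge_inverse_DR order_ge_Sp PS
          Sp_power Sp_minus Sp_1)
    moreover have "int k \<le> 0 + (0 + (int CARD('p) * int (CARD('p) ^ n) + - 1))"
    proof -
      have "n < 2 ^ n" by (rule less_exp)
      also have "(2::nat) ^ n \<le> CARD('p) ^ n" using CARD_ge_2 by (rule power_mono) simp
      also have "\<dots> \<le> CARD('p) * CARD('p) ^ n" using CARD_ge_2[where 'p='p] by simp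
      finally have "Suc k \<le> CARD('p) * CARD('p) ^ n" by (simp add: n_def)
      then have "int (Suc k) \<le> int (CARD('p) * CARD('p) ^ n)" by (simp only: of_nat_le_iff)
      then show ?thesis by simp
    qed
    ultimately have c: "order_ge (int k) (Rp_deriv (P n) - P n)" by (metis order_ge_mono)
    show "order_ge (int k) (Rp_deriv exp_tilde - (exp_tilde :: 'p Rp))"
      by (rule order_ge_trans[OF a order_ge_trans[OF c b]])
  qed
  then show "Rp_deriv (exp_tilde :: 'p Rp) = exp_tilde" by simp
qed

end
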